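(* Let $n,i,j,p$ be integers with $0<i<j\le n/2$ and $p\ge 1$, such that either $i=1$ or neither $i$ nor $j$ is a unit in $\mathbb{Z}_n$. Assume $C_n(i,j)$ is connected (equivalently $\gcd(n,i,j)=1$). Then $\operatorname{Aut}(C_n(i_\div p,j))=\mathbb{Z}_n\rtimes H'$, where $(s,t)\in\mathbb{Z}_n\rtimes H'$ acts as the automorphism $\alpha$ given by $$\alpha(x)=\begin{cases}u_{s+ta}, & x=u_a,\\ v_{s+ta}^{r}, & x=v_a^r \text{ and } ti\equiv i,\\ v_{s+ta-i}^{(p+1)-r}, & x=v_a^r\text{ and } ti\equiv -i.\end{cases}$$
   Context: $C_n(i,j)$ is the simple undirected graph with vertex set $\mathbb{Z}_n$ in which $a,b$ are adjacent iff $a-b\equiv\pm i$ or $a-b\equiv\pm j\pmod n$. The subdivided graph $C_n(i_\div p,j)$ has vertices $u_a$ ($a\in\mathbb{Z}_n$) and $v_a^r$ ($a\in\mathbb{Z}_n$, $1\le r\le p$), with edges $u_au_{a+j}$ for all $a\in\mathbb{Z}_n$, and, for each $a\in\mathbb{Z}_n$, the edges of the path $(u_a,v_a^1,v_a^2,\dots,v_a^p,u_{a+i})$. $U(n)$ is the group of units of $\mathbb{Z}_n$, and $H'=\{t\in U(n): t\{\pm i\}=\{\pm i\}\text{ and }t\{\pm j\}=\{\pm j\}\}$. Multiplication in $\mathbb{Z}_n\rtimes H'$ is $(s,t)(s',t')=(s+ts',tt')$. *)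

theory Defs
  imports
    "HOL-Algebra.Bij"
    "HOL-Number_Theory.Residues"
    "Graph_Theory.Graph_Theory"
begin

text \<open>
  Throughout, \<open>\<int>\<^sub>n\<close> is the ring \<^const>\<open>residue_ring\<close> \<open>n\<close>, with carrier \<open>{0..n - 1}\<close>.
  A simple undirected graph is a pair digraph whose arc set is symmetric and irreflexive
  (\<^locale>\<open>pair_graph\<close>).
\<close>

definition circulant :: "int \<Rightarrow> int \<Rightarrow> int \<Rightarrow> int pair_pre_digraph" where
  "circulant n i j =
     \<lparr>pverts = carrier (residue_ring n),
      parcs = {(a, b). a \<in> carrier (residue_ring n) \<and> b \<in> carrier (residue_ring n) \<and>
        ([a - b = i] (mod n) \<or> [a - b = - i] (mod n) \<or>
         [a - b = j] (mod n) \<or> [a - b = - j] (mod n))}\<rparr>"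

text \<open>\<open>Orig a\<close> is \<open>u\<^sub>a\<close> and \<open>Subdiv a r\<close> is \<open>v\<^sub>a\<^sup>r\<close>.\<close>

datatype subdiv_vertex = Orig int | Subdiv int int

definition subdiv_path :: "int \<Rightarrow> int \<Rightarrow> int \<Rightarrow> int \<Rightarrow> subdiv_vertex list" where
  "subdiv_path n i p a = [Orig a] @ map (Subdiv a) [1..p] @ [Orig ((a + i) mod n)]"

text \<open>\<^const>\<open>vwalk_arcs\<close> lists the pairs of consecutive vertices.\<close>

definition subdiv_arcs :: "int \<Rightarrow> int \<Rightarrow> int \<Rightarrow> int \<Rightarrow> subdiv_vertex rel" where
  "subdiv_arcs n i p j =
     {(Orig a, Orig ((a + j) mod n)) | a. a \<in> carrier (residue_ring n)} \<union>
     (\<Union>a\<in>carrier (residue_ring n). set (vwalk_arcs (subdiv_path n i p a)))"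

definition subdivided_circulant ::
    "int \<Rightarrow> int \<Rightarrow> int \<Rightarrow> int \<Rightarrow> subdiv_vertex pair_pre_digraph" where
  "subdivided_circulant n i p j =
     \<lparr>pverts = {Orig a | a. a \<in> carrier (residue_ring n)} \<union>
        {Subdiv a r | a r. a \<in> carrier (residue_ring n) \<and> 1 \<le> r \<and> r \<le> p},
      parcs = subdiv_arcs n i p j \<union> (subdiv_arcs n i p j)\<inverse>\<rparr>"

text \<open>
  As in \<^const>\<open>BijGroup\<close>, automorphisms are taken to be extensional (\<^const>\<open>undefined\<close> outside
  the vertex set), so that each one is represented by exactly one function.
\<close>

definition graph_auts :: "'a pair_pre_digraph \<Rightarrow> ('a \<Rightarrow> 'a) set" where
  "graph_auts G = {f \<in> Bij (pverts G).
     \<forall>x\<in>pverts G. \<forall>y\<in>pverts G. (x, y) \<in> parcs G \<longleftrightarrow> (f x, f y) \<in> parcs G}"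

definition graph_aut_group :: "'a pair_pre_digraph \<Rightarrow> ('a \<Rightarrow> 'a) monoid" where
  "graph_aut_group G = BijGroup (pverts G) \<lparr>carrier := graph_auts G\<rparr>"

definition H' :: "int \<Rightarrow> int \<Rightarrow> int \<Rightarrow> int set" where
  "H' n i j = {t \<in> Units (residue_ring n).
     (\<lambda>x. t * x mod n) ` {i mod n, (- i) mod n} = {i mod n, (- i) mod n} \<and>
     (\<lambda>x. t * x mod n) ` {j mod n, (- j) mod n} = {j mod n, (- j) mod n}}"

definition semidirect :: "('a, 'b) ring_scheme \<Rightarrow> 'a set \<Rightarrow> ('a \<times> 'a) monoid" where
  "semidirect R H =
     \<lparr>carrier = carrier R \<times> H,
      monoid.mult = (\<lambda>(s, t) (s', t'). (s \<oplus>\<^bsub>R\<^esub> t \<otimes>\<^bsub>R\<^esub> s', t \<otimes>\<^bsub>R\<^esub> t')),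
      monoid.one = (\<zero>\<^bsub>R\<^esub>, \<one>\<^bsub>R\<^esub>)\<rparr>"

definition subdiv_action ::
    "int \<Rightarrow> int \<Rightarrow> int \<Rightarrow> int \<Rightarrow> int \<times> int \<Rightarrow> subdiv_vertex \<Rightarrow> subdiv_vertex" where
  "subdiv_action n i p j = (\<lambda>(s, t). restrict
     (\<lambda>x. case x of
        Orig a \<Rightarrow> Orig ((s + t * a) mod n)
      | Subdiv a r \<Rightarrow>
          if [t * i = i] (mod n) then Subdiv ((s + t * a) mod n) r
          else if [t * i = - i] (mod n) then Subdiv ((s + t * a - i) mod n) ((p + 1) - r)
          else undefined)
     (pverts (subdivided_circulant n i p j)))"


lemma pair_graph_circulant:
  assumes "0 < i" "i < j" "2 * j \<le> n"
  shows "pair_graph (circulant n i j)"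
proof -
  have fin: "finite (carrier (residue_ring n))"
    by (simp add: residue_ring_def)
  have nl: "\<not> [0 = i] (mod n)" "\<not> [0 = - i] (mod n)" "\<not> [0 = j] (mod n)" "\<not> [0 = - j] (mod n)"
    using assms by (auto simp: cong_iff_dvd_diff dest: zdvd_imp_le)
  have neg: "[b - a = - c] (mod n)" if "[a - b = c] (mod n)" for a b c :: int
    using cong_minus_minus_iff[of "a - b" c n] that by simp
  have sym: "symmetric (with_proj (circulant n i j))"
    unfolding symmetric_def
    by (rule symI) (use neg in \<open>fastforce simp: circulant_def\<close>)
  have "finite (parcs (circulant n i j))"
    by (rule finite_subset[of _ "carrier (residue_ring n) \<times> carrier (residue_ring n)"])
       (auto simp: circulant_def fin)
  with sym fin nl show ?thesis
    by unfold_locales (auto simp: circulant_def)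
qed

lemma group_graph_aut_group: "group (graph_aut_group G)"
proof -
  interpret B: group "BijGroup (pverts G)" by (rule group_BijGroup)
  let ?V = "pverts G"
  have "subgroup (graph_auts G) (BijGroup ?V)"
  proof (rule B.subgroupI)
    show "graph_auts G \<subseteq> carrier (BijGroup ?V)"
      by (auto simp: graph_auts_def BijGroup_def)
    show "graph_auts G \<noteq> {}"
      using id_Bij[of ?V] by (auto simp: graph_auts_def intro!: exI[of _ "\<lambda>x\<in>?V. x"])
  next
    fix f assume f: "f \<in> graph_auts G"
    then have fB: "f \<in> Bij ?V" by (simp add: graph_auts_def)
    have i: "inv\<^bsub>BijGroup ?V\<^esub> f = (\<lambda>x\<in>?V. inv_into ?V f x)"
      by (rule inv_BijGroup[OF fB])
    have im: "f ` ?V = ?V" using fB by (simp add: Bij_def bij_betw_def)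
    have "(x, y) \<in> parcs G \<longleftrightarrow> (inv_into ?V f x, inv_into ?V f y) \<in> parcs G"
      if "x \<in> ?V" "y \<in> ?V" for x y
    proof -
      have "inv_into ?V f x \<in> ?V" "inv_into ?V f y \<in> ?V"
        "f (inv_into ?V f x) = x" "f (inv_into ?V f y) = y"
        using that im by (auto simp: inv_into_into f_inv_into_f)
      with f show ?thesis by (auto simp: graph_auts_def)
    qed
    then show "inv\<^bsub>BijGroup ?V\<^esub> f \<in> graph_auts G"
      using restrict_inv_into_Bij[OF fB] by (simp add: i graph_auts_def)
  next
    fix f g assume fg: "f \<in> graph_auts G" "g \<in> graph_auts G"
    then have B: "f \<in> Bij ?V" "g \<in> Bij ?V" by (simp_all add: graph_auts_def)
    have "(x, y) \<in> parcs G \<longleftrightarrow> (f (g x), f (g y)) \<in> parcs G"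
      if "x \<in> ?V" "y \<in> ?V" for x y
    proof -
      have "g x \<in> ?V" "g y \<in> ?V" using B(2) that by (auto dest!: Bij_imp_funcset)
      with fg that show ?thesis by (simp add: graph_auts_def)
    qed
    then show "f \<otimes>\<^bsub>BijGroup ?V\<^esub> g \<in> graph_auts G"
      using B by (simp add: graph_auts_def BijGroup_def compose_Bij compose_eq)
  qed
  then show ?thesis
    unfolding graph_aut_group_def by (rule B.subgroup_imp_group)
qed

lemma group_semidirect:
  fixes R (structure)
  assumes "ring R" and "subgroup H (units_of R)"
  shows "group (semidirect R H)"
proof -
  interpret ring R by fact
  interpret U: group "units_of R" by (rule units_group)
  interpret H: subgroup H "units_of R" by fact
  have HU: "t \<in> Units R" if "t \<in> H" for t
    using H.subset that by (auto simp: units_of_carrier)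
  have HC: "t \<in> carrier R" if "t \<in> H" for t
    using HU that by auto
  have Hm: "t \<otimes> t' \<in> H" if "t \<in> H" "t' \<in> H" for t t'
    using H.m_closed[OF that] by (simp add: units_of_mult)
  have H1: "\<one> \<in> H"
    using H.one_closed by (simp add: units_of_one)
  have Hi: "inv t \<in> H" if "t \<in> H" for t
    using H.m_inv_closed[OF that] units_of_inv[OF HU[OF that]] by simp
  show ?thesis
  proof (rule groupI)
    fix x y z
    assume "x \<in> carrier (semidirect R H)" "y \<in> carrier (semidirect R H)"
      "z \<in> carrier (semidirect R H)"
    then show "x \<otimes>\<^bsub>semidirect R H\<^esub> y \<otimes>\<^bsub>semidirect R H\<^esub> z =
        x \<otimes>\<^bsub>semidirect R H\<^esub> (y \<otimes>\<^bsub>semidirect R H\<^esub> z)"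
      by (auto simp: semidirect_def HC Hm r_distr l_distr m_assoc a_assoc)
  next
    fix x assume x: "x \<in> carrier (semidirect R H)"
    then obtain s t where st: "x = (s, t)" "s \<in> carrier R" "t \<in> H"
      by (auto simp: semidirect_def)
    have "(\<ominus> (inv t \<otimes> s), inv t) \<otimes>\<^bsub>semidirect R H\<^esub> x = \<one>\<^bsub>semidirect R H\<^esub>"
      using st by (auto simp: semidirect_def HU HC Hi l_neg)
    moreover have "(\<ominus> (inv t \<otimes> s), inv t) \<in> carrier (semidirect R H)"
      using st by (auto simp: semidirect_def HC Hi)
    ultimately show "\<exists>y\<in>carrier (semidirect R H).
        y \<otimes>\<^bsub>semidirect R H\<^esub> x = \<one>\<^bsub>semidirect R H\<^esub>" by blast
  qed (auto simp: semidirect_def HC Hm H1)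
qed

lemma pair_graph_subdivided_circulant:
  assumes "0 < i" "i < j" "2 * j \<le> n" "1 \<le> p"
  shows "pair_graph (subdivided_circulant n i p j)"
proof -
  let ?G = "subdivided_circulant n i p j"
  let ?Z = "carrier (residue_ring n)"
  have fin: "finite ?Z"
    by (simp add: residue_ring_def)
  have modZ: "x mod n \<in> ?Z" for x
    using assms by (simp add: residue_ring_def)
  have nl: "(a + j) mod n \<noteq> a" if "a \<in> ?Z" for a
  proof
    assume "(a + j) mod n = a"
    then have "[a + j = a] (mod n)"
      using that by (metis cong_mod_left cong_refl)
    then have "n dvd j"
      by (simp add: cong_iff_dvd_diff)
    then show False
      using assms by (auto dest: zdvd_imp_le)
  qed
  have walk: "x \<in> set w \<and> y \<in> set w" if "(x, y) \<in> set (vwalk_arcs w)" for x y :: subdiv_vertex and w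
    using that by (induction w rule: vwalk_arcs.induct) auto
  have walk_neq: "x \<noteq> y" if "(x, y) \<in> set (vwalk_arcs w)" "distinct w" for x y :: subdiv_vertex and w
    using that by (induction w rule: vwalk_arcs.induct) auto
  have pathV: "set (subdiv_path n i p a) \<subseteq> pverts ?G" if "a \<in> ?Z" for a
    using that modZ by (auto simp: subdiv_path_def subdivided_circulant_def)
  have path_neq: "x \<noteq> y" if "(x, y) \<in> set (vwalk_arcs (subdiv_path n i p a))" for x y a
  proof -
    let ?w = "map (Subdiv a) [1..p] @ [Orig ((a + i) mod n)]"
    have "subdiv_path n i p a = Orig a # ?w" "?w \<noteq> []"
      by (simp_all add: subdiv_path_def)
    then have "(x, y) = (Orig a, hd ?w) \<or> (x, y) \<in> set (vwalk_arcs ?w)"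
      using that by simp
    moreover have "hd ?w \<noteq> Orig a"
      using assms(4) by (simp add: hd_append hd_map)
    moreover have "distinct ?w"
      by (auto simp: distinct_map inj_on_def)
    ultimately show ?thesis
      using walk_neq[of x y ?w] by (metis prod.inject)
  qed
  have arcs: "x \<in> pverts ?G \<and> y \<in> pverts ?G \<and> x \<noteq> y" if "(x, y) \<in> subdiv_arcs n i p j" for x y
    using that unfolding subdiv_arcs_def
  proof (elim UnE UN_E)
    assume "(x, y) \<in> {(Orig a, Orig ((a + j) mod n)) | a. a \<in> ?Z}"
    then show ?thesis
      using modZ nl by (fastforce simp: subdivided_circulant_def)
  next
    fix a assume "a \<in> ?Z" "(x, y) \<in> set (vwalk_arcs (subdiv_path n i p a))"
    then show ?thesis
      using walk pathV path_neq by blast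
  qed
  have parcs: "parcs ?G = subdiv_arcs n i p j \<union> (subdiv_arcs n i p j)\<inverse>"
    by (simp add: subdivided_circulant_def)
  have finV: "finite (pverts ?G)"
  proof -
    have "pverts ?G = Orig ` ?Z \<union> (\<lambda>(a, r). Subdiv a r) ` (?Z \<times> {1..p})"
      by (force simp: subdivided_circulant_def)
    then show ?thesis by (simp add: fin)
  qed
  have "finite (parcs ?G)"
    by (rule finite_subset[of _ "pverts ?G \<times> pverts ?G"]) (use arcs parcs finV in auto)
  moreover have "symmetric (with_proj ?G)"
    unfolding symmetric_def by (rule symI) (auto simp: parcs)
  ultimately show ?thesis
    using finV by unfold_locales (auto simp: parcs dest: arcs)
qed

lemma subgroup_H':
  assumes "1 < n"
  shows "subgroup (H' n i j) (units_of (residue_ring n))"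
proof -
  interpret residues n "residue_ring n" using assms by unfold_locales simp
  interpret U: group "units_of (residue_ring n)" by (rule units_group)
  let ?S = "\<lambda>k. {k mod n, (- k) mod n}"
  let ?P = "\<lambda>t k. (\<lambda>x. t * x mod n) ` ?S k = ?S k"
  have one: "?P 1 k" for k by simp
  have mult: "?P (t * t' mod n) k" if "?P t k" "?P t' k" for t t' k
  proof -
    have "(\<lambda>x. (t * t' mod n) * x mod n) = (\<lambda>x. t * x mod n) \<circ> (\<lambda>x. t' * x mod n)"
      by (auto simp: fun_eq_iff mod_simps mult.assoc)
    then show ?thesis using that by (simp only: image_comp[symmetric])
  qed
  have inv: "?P t' k" if "?P t k" "t' * t mod n = 1" for t t' k
  proof -
    have "(\<lambda>x. t' * x mod n) ` ?S k = (\<lambda>x. t' * x mod n) ` ((\<lambda>x. t * x mod n) ` ?S k)"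
      using that(1) by simp
    also have "\<dots> = (\<lambda>x. (t' * t mod n) * x mod n) ` ?S k"
      by (simp only: image_comp) (rule image_cong, auto simp: mod_simps mult.assoc)
    also have "\<dots> = ?S k" unfolding that(2) by simp
    finally show ?thesis .
  qed
  show ?thesis
  proof (rule U.subgroupI)
    show "H' n i j \<subseteq> carrier (units_of (residue_ring n))"
      by (auto simp: H'_def units_of_carrier)
    have "1 \<in> Units (residue_ring n)"
      using Units_one_closed by (simp add: res_one_eq assms)
    then have "1 \<in> H' n i j"
      using one[of i] one[of j] by (simp add: H'_def)
    then show "H' n i j \<noteq> {}"
      by blast
  next
    fix t assume t: "t \<in> H' n i j"
    then have tU: "t \<in> Units (residue_ring n)" by (simp add: H'_def)
    let ?t = "inv\<^bsub>residue_ring n\<^esub> t"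
    have "?t * t mod n = 1"
      using Units_l_inv[OF tU] by (simp add: res_mult_eq res_one_eq)
    then have "?t \<in> H' n i j"
      using t inv[of t _ ?t] Units_inv_Units[OF tU] by (simp add: H'_def)
    then show "inv\<^bsub>units_of (residue_ring n)\<^esub> t \<in> H' n i j"
      by (simp add: units_of_inv[OF tU])
  next
    fix t t' assume t: "t \<in> H' n i j" "t' \<in> H' n i j"
    then have "t \<otimes>\<^bsub>residue_ring n\<^esub> t' \<in> Units (residue_ring n)"
      by (auto simp: H'_def)
    with t mult show "t \<otimes>\<^bsub>units_of (residue_ring n)\<^esub> t' \<in> H' n i j"
      by (simp add: units_of_mult H'_def res_mult_eq)
  qed
qed

end

theory Submission
  imports Defs
begin

text \<open>
  The vertices \<open>v\<^sub>a\<^sup>r\<close> have two neighbours and the vertices \<open>u\<^sub>a\<close> at least three, so an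
  automorphism \<open>f\<close> permutes the \<open>u\<^sub>a\<close>, say \<open>f u\<^sub>a = u\<^bsub>h a\<^esub>\<close>. A walk that enters a subdivided edge
  and never turns back runs through it to the other end. Hence \<open>f\<close> maps each subdivided edge onto
  a subdivided edge, vertex by vertex and possibly reversed (\<open>aut_path\<close>). So \<open>f\<close> is determined
  by \<open>h\<close>, and \<open>h\<close> satisfies \<open>h (a + i) = h a \<plusminus> i\<close> and \<open>h (a + j) = h a \<plusminus> j\<close>, with signs that may
  depend on \<open>a\<close>.

  What remains is arithmetic: \<open>h\<close> is affine (\<open>cong_map_affine\<close>). Since \<open>h\<close> is injective and
  \<open>2i \<noteq> 0\<close>, the \<open>i\<close>-sign is constant along each coset of \<open>\<langle>i\<rangle>\<close>. For \<open>i = 1\<close> there is one coset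
  and \<open>h a = h 0 \<plusminus> a\<close>. Otherwise, compare the two ways from \<open>h a\<close> to \<open>h (a + i + j)\<close>: if the
  \<open>i\<close>-sign changed from \<open>a\<close> to \<open>a + j\<close>, then \<open>2i\<close> would be \<open>0\<close> or \<open>\<plusminus>2j\<close>. The first is impossible,
  and the second, for non-units \<open>i\<close> and \<open>j\<close>, makes \<open>i\<close>, \<open>j\<close> and \<open>n\<close> all even
  (\<open>non_coprime_double_cong_False\<close>), against connectedness. The \<open>j\<close>-sign is constant along
  \<open>\<langle>j\<rangle>\<close> for the same reason as the \<open>i\<close>-sign along \<open>\<langle>i\<rangle>\<close>, or can be chosen so if \<open>2j = 0\<close>.
  By connectedness every element is \<open>x i + y j\<close>, and walking from \<open>0\<close> first in \<open>j\<close>-steps and then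
  in \<open>i\<close>-steps shows that \<open>h (x i + y j) - h 0\<close> is additive in \<open>x\<close> and \<open>y\<close>.

  Writing every vertex as a point on a path of length \<open>p + 1\<close> treats the two kinds of vertices and
  both ends of a subdivided edge alike; the action
  maps paths to paths, keeping the direction if \<open>t i = i\<close> and reversing it if \<open>t i = - i\<close>, and the
  homomorphism law is read off from its effect on these points.
\<close>

section \<open>Signs and steps modulo n\<close>

text \<open>
  The image is \<open>{t k, - t k}\<close>, so the defining condition of \<open>H'\<close> is a sign condition on one
  element.
\<close>

lemma image_signed_pair_iff:
  fixes n t k :: int
  shows "(\<lambda>x. t * x mod n) ` {k mod n, (- k) mod n} = {k mod n, (- k) mod n} \<longleftrightarrow>
    [t * k = k] (mod n) \<or> [t * k = - k] (mod n)"
proof -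
  have im: "(\<lambda>x. t * x mod n) ` {k mod n, (- k) mod n} = {t * k mod n, (- (t * k)) mod n}"
    by (simp add: mod_mult_right_eq)
  show ?thesis
    unfolding im cong_def
  proof
    assume "{t * k mod n, (- (t * k)) mod n} = {k mod n, (- k) mod n}"
    then show "t * k mod n = k mod n \<or> t * k mod n = (- k) mod n" by blast
  next
    assume "t * k mod n = k mod n \<or> t * k mod n = (- k) mod n"
    moreover have "(- (t * k)) mod n = (- x) mod n" if "t * k mod n = x mod n" for x
      using that by (metis mod_minus_eq)
    ultimately show "{t * k mod n, (- (t * k)) mod n} = {k mod n, (- k) mod n}"
      by fastforce
  qed
qed

lemma shift_invariant_multiple:
  fixes e :: "int \<Rightarrow> 'a" and c :: int
  assumes const: "\<And>x. e (x + c) = e x"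
  shows "e (x + k * c) = e x"
proof (induction k rule: int_induct[where k = 0])
  case (step1 k)
  then show ?case using const[of "x + k * c"] by (simp add: algebra_simps)
next
  case (step2 k)
  then show ?case using const[of "x + (k - 1) * c"] by (simp add: algebra_simps)
qed simp

lemma signed_progression:
  fixes n c :: int and f e :: "int \<Rightarrow> int"
  assumes step: "\<And>x. [f (x + c) = f x + e x * c] (mod n)"
    and const: "\<And>x. e (x + c) = e x"
  shows "[f (x + k * c) = f x + k * (e x * c)] (mod n)"
proof -
  have step': "[f (x + k * c + c) = f (x + k * c) + e x * c] (mod n)" for k
    using step[of "x + k * c"] shift_invariant_multiple[of e, OF const] by simp
  show ?thesis
  proof (induction k rule: int_induct[where k = 0])
    case base
    show ?case by simp
  next
    case (step1 k)
    have "[f (x + k * c) + e x * c = f x + k * (e x * c) + e x * c] (mod n)"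
      using step1 by (simp add: cong_add_rcancel)
    with step'[of k] show ?case
      by (auto simp: algebra_simps intro: cong_trans)
  next
    case (step2 k)
    have "[f (x + (k - 1) * c) + e x * c = f (x + k * c)] (mod n)"
      using step'[of "k - 1"] by (simp add: algebra_simps cong_sym_eq)
    also have "[f (x + k * c) = f x + k * (e x * c)] (mod n)"
      using step2 by simp
    also have "f x + k * (e x * c) = f x + (k - 1) * (e x * c) + e x * c"
      by (simp add: algebra_simps)
    finally show ?case
      by (simp add: cong_add_rcancel)
  qed
qed

text \<open>
  A sign change would make two consecutive steps cancel, so that \<open>f\<close> would take the same value at
  \<open>x\<close> and at \<open>x + 2c\<close>.
\<close>

lemma sign_shift_invariant:
  fixes n c :: int and f e :: "int \<Rightarrow> int"
  assumes inj: "\<And>x y. [f x = f y] (mod n) \<Longrightarrow> [x = y] (mod n)"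
    and step: "\<And>x. [f (x + c) = f x + e x * c] (mod n)"
    and sign: "\<And>x. e x \<in> {1, - 1}"
    and c: "\<not> [2 * c = 0] (mod n)"
  shows "e (x + c) = e x"
proof (rule ccontr)
  assume "e (x + c) \<noteq> e x"
  then have e: "e (x + c) = - e x"
    using sign[of x] sign[of "x + c"] by auto
  have "[f (x + c + c) = f (x + c) + e (x + c) * c] (mod n)"
    by (rule step)
  also have "[f (x + c) + e (x + c) * c = f x + e x * c + e (x + c) * c] (mod n)"
    using step[of x] by (simp add: cong_add_rcancel)
  also have "f x + e x * c + e (x + c) * c = f x"
    by (simp add: e)
  finally have "[x + c + c = x] (mod n)"
    by (rule inj)
  then have "[2 * c = 0] (mod n)"
    using cong_add_lcancel_0[of x "c + c" n] by (simp add: algebra_simps)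
  with c show False by contradiction
qed

text \<open>
  A common divisor of \<open>i\<close>, \<open>j\<close> and \<open>n\<close> is a unit. Hence \<open>gcd i n\<close> is coprime to \<open>j\<close>, and as it divides
  \<open>2j\<close>, it divides \<open>2\<close>; not being \<open>1\<close>, it is \<open>2\<close>. By symmetry \<open>gcd j n = 2\<close>, so that \<open>2\<close> is a common
  divisor after all.
\<close>

lemma non_coprime_double_cong_False:
  fixes n i j :: int
  assumes bezout: "[u * i + v * j = 1] (mod n)"
    and ni: "\<not> coprime i n" and nj: "\<not> coprime j n"
    and double: "n dvd 2 * i - w * j" "w = 2 \<or> w = - 2"
  shows False
proof -
  have common: "is_unit d" if "d dvd n" "d dvd i" "d dvd j" for d
  proof -
    have "d dvd u * i + v * j - 1"
      using bezout that(1) by (auto simp: cong_iff_dvd_diff intro: dvd_trans)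
    moreover have "d dvd u * i + v * j"
      using that by simp
    ultimately show "is_unit d"
      by (metis dvd_diff_right_iff dvd_add_right_iff diff_add_cancel)
  qed
  have even: "even a \<and> even n" if na: "\<not> coprime a n" and d: "n dvd 2 * a - w' * b" and w': "w' = 2 \<or> w' = - 2"
    and ab: "\<And>d. d dvd n \<Longrightarrow> d dvd a \<Longrightarrow> d dvd b \<Longrightarrow> is_unit d" for a b w' :: int
  proof -
    let ?d = "gcd a n"
    have "coprime ?d b"
      using ab by (intro coprimeI) auto
    moreover have "?d dvd w' * b"
      using dvd_trans[OF gcd_dvd2 d, of a] by (metis dvd_diff_right_iff dvd_mult gcd_dvd1)
    ultimately have "?d dvd 2"
      using w' by (auto simp: coprime_dvd_mult_left_iff)
    moreover have "?d \<noteq> 1"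
      using na by (simp add: coprime_iff_gcd_eq_1)
    moreover have "0 \<le> ?d" "?d \<noteq> 0"
      using \<open>?d dvd 2\<close> by auto
    ultimately have "?d = 2"
      using zdvd_imp_le[of ?d 2] by linarith
    then show ?thesis by (metis gcd_dvd1 gcd_dvd2)
  qed
  have "even i \<and> even n"
    by (rule even[OF ni double]) (rule common)
  moreover have "even j \<and> even n"
  proof (rule even[OF nj _ double(2)])
    show "n dvd 2 * j - w * i"
    proof -
      have "2 * j - w * i = - (w div 2) * (2 * i - w * j)"
        using double(2) by auto
      then show ?thesis using double(1) by simp
    qed
  qed (rule common)
  ultimately show False
    using common[of 2] by simp
qed

text \<open>
  The hypotheses say that \<open>f\<close> induces an injective map on \<open>\<int>\<^sub>n\<close> that preserves \<open>i\<close>-edges and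
  \<open>j\<close>-edges. The signs \<open>e\<close> and \<open>d\<close> of the \<open>i\<close>- and \<open>j\<close>-steps are constant along the
  multiples of \<open>i\<close> and of \<open>j\<close> respectively, and \<open>e\<close> is also unchanged by adding \<open>j\<close>, unless
  \<open>i = 1\<close>. So going from \<open>0\<close> to \<open>x\<close> first in \<open>j\<close>-steps and then in \<open>i\<close>-steps evaluates \<open>f x\<close>.
\<close>

lemma cong_map_affine:
  fixes n i j :: int and f :: "int \<Rightarrow> int"
  assumes cong: "\<And>x y. [x = y] (mod n) \<longleftrightarrow> [f x = f y] (mod n)"
    and i_step: "\<And>x. [f (x + i) = f x + i] (mod n) \<or> [f (x + i) = f x - i] (mod n)"
    and j_step: "\<And>x. [f (x + j) = f x + j] (mod n) \<or> [f (x + j) = f x - j] (mod n)"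
    and i2: "\<not> [2 * i = 0] (mod n)"
    and bezout: "[u * i + v * j = 1] (mod n)"
    and units: "i = 1 \<or> \<not> coprime i n \<and> \<not> coprime j n"
  obtains t where "\<And>x. [f x = f 0 + t * x] (mod n)"
    "[t * i = i] (mod n) \<or> [t * i = - i] (mod n)"
    "[t * j = j] (mod n) \<or> [t * j = - j] (mod n)"
proof -
  define e where "e x = (if [f (x + i) = f x + i] (mod n) then 1 else - 1 :: int)" for x
  have e_sign: "e x \<in> {1, - 1}" for x by (simp add: e_def)
  have e_step: "[f (x + i) = f x + e x * i] (mod n)" for x
    using i_step[of x] by (auto simp: e_def)
  have e_i: "e (x + i) = e x" for x
    by (rule sign_shift_invariant[where f = f and n = n and e = e and c = i])
      (use cong e_step e_sign i2 in auto)
  have e_prog: "[f (x + k * i) = f x + k * (e x * i)] (mod n)" for x k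
    by (rule signed_progression[where f = f and e = e, OF e_step e_i])
  show ?thesis
  proof (cases "i = 1")
    case True
    show ?thesis
    proof
      show "[f x = f 0 + e 0 * x] (mod n)" for x
        using e_prog[of 0 x] True by (simp add: mult.commute)
    qed (use e_sign[of 0] in auto)
  next
    case False
    then have ni: "\<not> coprime i n" and nj: "\<not> coprime j n"
      using units by auto
    \<comment> \<open>If \<open>2 j = 0\<close>, both signs describe the same step, and a fixed choice makes \<open>d\<close> constant.\<close>
    define d where "d x = (if [2 * j = 0] (mod n) \<or> [f (x + j) = f x + j] (mod n)
      then 1 else - 1 :: int)" for x
    have d_sign: "d x \<in> {1, - 1}" for x by (simp add: d_def)
    have d_step: "[f (x + j) = f x + d x * j] (mod n)" for x
    proof (cases "[2 * j = 0] (mod n)")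
      case True
      then have "[f x - j + 2 * j = f x - j + 0] (mod n)"
        by (intro cong_add cong_refl)
      moreover have "f x - j + 2 * j = f x + j"
        by simp
      ultimately have "[f x - j = f x + j] (mod n)"
        by (simp add: cong_sym_eq)
      with True j_step[of x] show ?thesis
        by (auto simp: d_def intro: cong_trans)
    qed (use j_step[of x] in \<open>auto simp: d_def\<close>)
    have d_j: "d (x + j) = d x" for x
    proof (cases "[2 * j = 0] (mod n)")
      case False
      show ?thesis
        by (rule sign_shift_invariant[where f = f and n = n and e = d and c = j])
          (use cong d_step d_sign False in auto)
    qed (simp add: d_def)
    have d_prog: "[f (x + k * j) = f x + k * (d x * j)] (mod n)" for x k
      by (rule signed_progression[where f = f and e = d, OF d_step d_j])
    \<comment> \<open>The two ways around the square \<open>x, x + i, x + i + j, x + j\<close>.\<close>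
    have square: "n dvd (e x - e (x + j)) * i - (d x - d (x + i)) * j" for x
    proof -
      have "[f x + e x * i + d (x + i) * j = f (x + i) + d (x + i) * j] (mod n)"
        using e_step[of x] by (simp add: cong_add_rcancel cong_sym_eq)
      also have "[f (x + i) + d (x + i) * j = f (x + i + j)] (mod n)"
        using d_step by (simp add: cong_sym_eq)
      also have "f (x + i + j) = f (x + j + i)" by (simp add: algebra_simps)
      also have "[f (x + j + i) = f (x + j) + e (x + j) * i] (mod n)"
        by (rule e_step)
      also have "[f (x + j) + e (x + j) * i = f x + d x * j + e (x + j) * i] (mod n)"
        using d_step[of x] by (simp add: cong_add_rcancel)
      finally show ?thesis
        by (simp add: cong_iff_dvd_diff algebra_simps)
    qed
    have e_j: "e (x + j) = e x" for x
    proof (rule ccontr)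
      assume "e (x + j) \<noteq> e x"
      then have e: "e x - e (x + j) = 2 * e x"
        using e_sign[of x] e_sign[of "x + j"] by auto
      \<comment> \<open>Multiplying the square relation by the sign \<open>e x\<close> normalizes the coefficient of \<open>i\<close> to \<open>2\<close>.\<close>
      define w where "w = e x * (d x - d (x + i))"
      have "e x * ((e x - e (x + j)) * i - (d x - d (x + i)) * j) = 2 * i - w * j"
        using e_sign[of x] unfolding e w_def by (auto simp: algebra_simps)
      then have dvd: "n dvd 2 * i - w * j"
        using square[of x] by (metis dvd_mult)
      have "w = 0 \<or> w = 2 \<or> w = - 2"
        using e_sign[of x] d_sign[of x] d_sign[of "x + i"] by (auto simp: w_def)
      then show False
        using dvd i2 non_coprime_double_cong_False[OF bezout ni nj dvd]
        by (auto simp: cong_0_iff)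
    qed
    define t where "t = u * (e 0 * i) + v * (d 0 * j)"
    have affine: "[f x = f 0 + t * x] (mod n)" for x
    proof -
      \<comment> \<open>The \<open>i\<close>-steps start from a multiple of \<open>j\<close>, where \<open>e\<close> still has the value \<open>e 0\<close>.\<close>
      have "[(u * i + v * j) * x = 1 * x] (mod n)"
        using bezout by (rule cong_scalar_right)
      then have "[f x = f (x * v * j + x * u * i)] (mod n)"
        unfolding cong[symmetric] by (simp add: cong_sym_eq algebra_simps)
      also have "[f (x * v * j + x * u * i) = f (x * v * j) + x * u * (e (x * v * j) * i)] (mod n)"
        by (rule e_prog)
      also have "e (x * v * j) = e 0"
        using shift_invariant_multiple[of e, OF e_j, of 0] by simp
      also have "[f (x * v * j) + x * u * (e 0 * i) =
          f 0 + x * v * (d 0 * j) + x * u * (e 0 * i)] (mod n)"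
        using d_prog[of 0 "x * v"] by (simp add: cong_add_rcancel)
      also have "f 0 + x * v * (d 0 * j) + x * u * (e 0 * i) = f 0 + t * x"
        by (simp add: t_def algebra_simps)
      finally show ?thesis .
    qed
    have slope: "[t * c = s * c] (mod n)" if "[f (0 + c) = f 0 + s * c] (mod n)" for c s
      using that affine[of c] by (metis add_0 cong_add_lcancel cong_sym cong_trans)
    show ?thesis
      using that[OF affine] slope[OF e_step] slope[OF d_step] e_sign[of 0] d_sign[of 0] by auto
  qed
qed

section \<open>Connected circulants\<close>

text \<open>
  A walk in the circulant changes the position by \<open>\<plusminus>i\<close> or \<open>\<plusminus>j\<close> at each step, so a walk from \<open>0\<close> to
  \<open>1\<close> exhibits \<open>1\<close> as a combination of \<open>i\<close> and \<open>j\<close>.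
\<close>

lemma circulant_connected_bezout:
  fixes n i j :: int
  assumes n: "1 < n" and conn: "Digraph_Component.connected (with_proj (circulant n i j))"
  obtains u v where "[u * i + v * j = 1] (mod n)"
proof -
  let ?H = "mk_symmetric (with_proj (circulant n i j))"
  let ?span = "\<lambda>x. \<exists>u v. [u * i + v * j = x] (mod n)"
  have "0 \<in> pverts (circulant n i j)" "1 \<in> pverts (circulant n i j)"
    using n by (auto simp: circulant_def residue_ring_def)
  then have "0 \<rightarrow>\<^sup>*\<^bsub>with_proj ?H\<^esub> 1"
    using conn by (auto simp: Digraph_Component.connected_def strongly_connected_def)
  then have "(0, 1) \<in> (parcs ?H)\<^sup>*"
    using reachable_rtranclI by fastforce
  then have "?span 1"
  proof induction
    case base
    have "[0 * i + 0 * j = 0] (mod n)" by simp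
    then show ?case by blast
  next
    case (step y z)
    from step(2) obtain k l where kl: "[k * i + l * j = z - y] (mod n)"
    proof -
      have "(y, z) \<in> parcs (circulant n i j) \<or> (z, y) \<in> parcs (circulant n i j)"
        using step(2) by (auto simp: parcs_mk_symmetric)
      then obtain c where c: "c \<in> {i, - i, j, - j}" "[y - z = c] (mod n) \<or> [z - y = c] (mod n)"
        by (auto simp: circulant_def)
      from c(2) have "[- c = z - y] (mod n) \<or> [c = z - y] (mod n)"
        using cong_minus_minus_iff[of "y - z" c n] by (auto simp: cong_sym_eq)
      with c(1) have "[1 * i + 0 * j = z - y] (mod n) \<or> [(- 1) * i + 0 * j = z - y] (mod n) \<or>
          [0 * i + 1 * j = z - y] (mod n) \<or> [0 * i + (- 1) * j = z - y] (mod n)"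
        by auto
      then show ?thesis using that by blast
    qed
    moreover from step obtain u v where "[u * i + v * j = y] (mod n)" by blast
    ultimately have "[u * i + v * j + (k * i + l * j) = y + (z - y)] (mod n)"
      by (intro cong_add)
    then have "[(u + k) * i + (v + l) * j = z] (mod n)"
      by (simp add: algebra_simps)
    then show ?case by blast
  qed
  then show ?thesis using that by blast
qed

section \<open>The subdivided circulant\<close>

lemma set_vwalk_arcs_map_upto:
  "set (vwalk_arcs (map g [l..m])) = (\<lambda>r. (g r, g (r + 1))) ` {l..<m}"
proof (induction l m rule: upto.induct)
  case (1 l m)
  show ?case
  proof (cases "l < m")
    case True
    then have "[l..m] = l # (l + 1) # [l + 2..m]"
      by (simp add: upto_rec1 add.commute)
    moreover have "[l + 1..m] = (l + 1) # [l + 2..m]"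
      using True by (simp add: upto_rec1 add.commute)
    moreover have "{l..<m} = insert l {l + 1..<m}"
      using True by auto
    ultimately show ?thesis
      using 1 True by simp
  next
    case False
    then show ?thesis
      by (cases "l = m") auto
  qed
qed

locale circulant_subdivision =
  fixes n i j p :: int
  assumes i_pos: "0 < i" and i_less_j: "i < j" and two_j_le: "2 * j \<le> n" and p_pos: "1 \<le> p"
begin

abbreviation "G \<equiv> subdivided_circulant n i p j"
abbreviation "V \<equiv> pverts G"
abbreviation "E \<equiv> parcs G"

text \<open>
  For \<open>r\<close> from \<open>0\<close> to \<open>p + 1\<close>, the points \<open>pt a r\<close> run along the path that replaces the edge from \<open>a\<close>
  to \<open>a + i\<close>, both ends included. The index \<open>a\<close> is any integer; reducing it inside the definition
  lets congruences replace reductions everywhere else. A vertex \<open>u\<^sub>a\<close> has the two names \<open>pt a 0\<close> and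
  \<open>pt (a - i) (p + 1)\<close>.
\<close>

definition pt :: "int \<Rightarrow> int \<Rightarrow> subdiv_vertex" where
  "pt a r = (if r \<le> 0 then Orig (a mod n) else if r \<le> p then Subdiv (a mod n) r
     else Orig ((a + i) mod n))"

lemma n_gt_1: "1 < n"
  using i_pos i_less_j two_j_le by linarith

lemma two_i_not_cong_0: "\<not> [2 * i = 0] (mod n)"
  using i_pos i_less_j two_j_le by (auto simp: cong_0_iff dest: zdvd_imp_le)

lemma not_cong_i_uminus_i: "\<not> ([x = i] (mod n) \<and> [x = - i] (mod n))"
proof
  assume "[x = i] (mod n) \<and> [x = - i] (mod n)"
  then have "[x - x = i - (- i)] (mod n)"
    using cong_diff by blast
  then show False
    using two_i_not_cong_0 by (simp add: cong_sym_eq)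
qed

lemma i_not_cong_0: "\<not> [i = 0] (mod n)"
  using two_i_not_cong_0 cong_scalar_left[of i 0 n 2] by auto

lemma carrier_iff: "a \<in> carrier (residue_ring n) \<longleftrightarrow> 0 \<le> a \<and> a < n"
  by (auto simp: residue_ring_def)

lemma pt_cong: "[a = b] (mod n) \<Longrightarrow> pt a r = pt b r"
  by (auto simp: pt_def cong_def intro: mod_add_cong)

lemma pt_0: "pt a 0 = Orig (a mod n)"
  by (simp add: pt_def)

lemma pt_inner: "1 \<le> r \<Longrightarrow> r \<le> p \<Longrightarrow> pt a r = Subdiv (a mod n) r"
  by (simp add: pt_def)

lemma pt_end: "pt a (p + 1) = pt (a + i) 0"
  using p_pos by (simp add: pt_def)

lemma pt_eq_inner_iff:
  assumes "1 \<le> r" "r \<le> p"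
  shows "pt b s = pt a r \<longleftrightarrow> s = r \<and> [b = a] (mod n)"
  using assms by (auto simp: pt_def cong_def)

lemma pt_0_eq_iff: "pt a 0 = pt b 0 \<longleftrightarrow> [a = b] (mod n)"
  by (simp add: pt_def cong_def)

lemma pt_mem: "pt a r \<in> V"
  using n_gt_1 by (auto simp: pt_def subdivided_circulant_def carrier_iff)

lemma vertex_cases:
  assumes "x \<in> V"
  obtains a r where "x = pt a r" "0 \<le> r" "r \<le> p"
proof -
  from assms consider a where "x = Orig a" "0 \<le> a" "a < n"
    | a r where "x = Subdiv a r" "0 \<le> a" "a < n" "1 \<le> r" "r \<le> p"
    by (auto simp: subdivided_circulant_def carrier_iff)
  then show ?thesis
  proof cases
    case 1
    then show ?thesis using that[of a 0] p_pos by (simp add: pt_def)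
  next
    case 2
    then show ?thesis using that[of a r] by (simp add: pt_def)
  qed
qed

lemma subdiv_path_eq:
  assumes "0 \<le> a" "a < n"
  shows "subdiv_path n i p a = map (pt a) [0..p + 1]"
proof -
  have "[0..p + 1] = 0 # [1..p] @ [p + 1]"
    using p_pos upto_rec2[of 0 "p + 1"] upto_rec1[of 0 p] by simp
  moreover have "map (pt a) [1..p] = map (Subdiv a) [1..p]"
    using assms by (auto simp: pt_def)
  ultimately show ?thesis
    using assms p_pos by (simp add: subdiv_path_def pt_def)
qed

lemma arcs_cases:
  "(x, y) \<in> subdiv_arcs n i p j \<longleftrightarrow>
     (\<exists>a. x = pt a 0 \<and> y = pt (a + j) 0) \<or>
     (\<exists>a r. 0 \<le> r \<and> r \<le> p \<and> x = pt a r \<and> y = pt a (r + 1))"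
    (is "_ \<longleftrightarrow> ?R")
proof
  assume "(x, y) \<in> subdiv_arcs n i p j"
  then consider a where "0 \<le> a" "a < n" "x = Orig a" "y = Orig ((a + j) mod n)"
    | a where "0 \<le> a" "a < n" "(x, y) \<in> set (vwalk_arcs (subdiv_path n i p a))"
    by (auto simp: subdiv_arcs_def carrier_iff)
  then show ?R
  proof cases
    case 1
    then have "x = pt a 0 \<and> y = pt (a + j) 0" by (simp add: pt_0)
    then show ?thesis by blast
  next
    case 2
    then obtain r where "0 \<le> r" "r < p + 1" "x = pt a r" "y = pt a (r + 1)"
      by (auto simp: subdiv_path_eq set_vwalk_arcs_map_upto)
    then show ?thesis by (metis zle_add1_eq_le)
  qed
next
  have red: "pt a r = pt (a mod n) r" for a r
    by (rule pt_cong) simp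
  have mem: "0 \<le> a mod n" "a mod n < n" "a mod n \<in> carrier (residue_ring n)" for a
    using n_gt_1 by (auto simp: carrier_iff)
  assume ?R
  then show "(x, y) \<in> subdiv_arcs n i p j"
  proof (elim disjE exE conjE)
    fix a assume "x = pt a 0" "y = pt (a + j) 0"
    then have "x = Orig (a mod n)" "y = Orig ((a mod n + j) mod n)"
      by (simp_all add: pt_0 mod_simps)
    then show ?thesis
      using mem(3)[of a] unfolding subdiv_arcs_def by blast
  next
    fix a r assume *: "0 \<le> r" "r \<le> p" "x = pt a r" "y = pt a (r + 1)"
    then have "(x, y) \<in> set (vwalk_arcs (subdiv_path n i p (a mod n)))"
      using red[of a] by (simp add: subdiv_path_eq[OF mem(1,2)] set_vwalk_arcs_map_upto)
    then show ?thesis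
      using mem(3)[of a] unfolding subdiv_arcs_def by blast
  qed
qed

lemma E_iff: "(x, y) \<in> E \<longleftrightarrow> (x, y) \<in> subdiv_arcs n i p j \<or> (y, x) \<in> subdiv_arcs n i p j"
  by (simp add: subdivided_circulant_def)

lemma E_sym: "(x, y) \<in> E \<Longrightarrow> (y, x) \<in> E"
  by (auto simp: E_iff)

lemma chord: "(pt a 0, pt (a + j) 0) \<in> E"
  using arcs_cases E_iff by blast

lemma path_step: "0 \<le> r \<Longrightarrow> r \<le> p \<Longrightarrow> (pt a r, pt a (r + 1)) \<in> E"
  using arcs_cases E_iff by blast

lemma inner_nbrs:
  assumes "1 \<le> r" "r \<le> p"
  shows "(pt a r, y) \<in> E \<longleftrightarrow> y = pt a (r - 1) \<or> y = pt a (r + 1)"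
proof
  assume "(pt a r, y) \<in> E"
  then consider "(pt a r, y) \<in> subdiv_arcs n i p j" | "(y, pt a r) \<in> subdiv_arcs n i p j"
    by (auto simp: E_iff)
  then show "y = pt a (r - 1) \<or> y = pt a (r + 1)"
  proof cases
    case 1
    then obtain b s where "y = pt b (s + 1)" "pt a r = pt b s"
      using assms by (auto simp: arcs_cases pt_inner pt_0)
    then show ?thesis
      using pt_eq_inner_iff[OF assms] pt_cong by metis
  next
    case 2
    then obtain b s where "y = pt b s" "pt a r = pt b (s + 1)"
      using assms by (auto simp: arcs_cases pt_inner pt_0)
    then show ?thesis
      using pt_eq_inner_iff[OF assms] pt_cong by (metis add_diff_cancel_right')
  qed
next
  have "(pt a (r - 1), pt a r) \<in> E"
    using path_step[of "r - 1" a] assms by simp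
  moreover assume "y = pt a (r - 1) \<or> y = pt a (r + 1)"
  ultimately show "(pt a r, y) \<in> E"
    using path_step[of r a] assms E_sym by auto
qed

lemma orig_nbrs:
  "(pt a 0, y) \<in> E \<longleftrightarrow> y \<in> {pt (a + j) 0, pt (a - j) 0, pt a 1, pt (a - i) p}"
proof
  assume "(pt a 0, y) \<in> E"
  then consider "(pt a 0, y) \<in> subdiv_arcs n i p j" | "(y, pt a 0) \<in> subdiv_arcs n i p j"
    by (auto simp: E_iff)
  then show "y \<in> {pt (a + j) 0, pt (a - j) 0, pt a 1, pt (a - i) p}"
  proof cases
    case 1
    then consider b where "pt a 0 = pt b 0" "y = pt (b + j) 0"
      | b r where "0 \<le> r" "r \<le> p" "pt a 0 = pt b r" "y = pt b (r + 1)"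
      by (auto simp: arcs_cases)
    then show ?thesis
    proof cases
      case 1
      then have "y = pt (a + j) 0"
        by (metis pt_0_eq_iff cong_add_rcancel)
      then show ?thesis by simp
    next
      case 2
      then have "r = 0" using pt_inner[of r b] by (cases "r = 0") (auto simp: pt_0)
      then have "y = pt a 1" using 2 pt_cong pt_0_eq_iff by auto
      then show ?thesis by simp
    qed
  next
    case 2
    then consider b where "pt a 0 = pt (b + j) 0" "y = pt b 0"
      | b r where "0 \<le> r" "r \<le> p" "pt a 0 = pt b (r + 1)" "y = pt b r"
      by (auto simp: arcs_cases)
    then show ?thesis
    proof cases
      case 1
      then have "[a - j = b] (mod n)"
        using cong_diff[of a "b + j" n j j] by (simp add: pt_0_eq_iff)
      then show ?thesis using 1 pt_cong by force
    next
      case 2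
      then have r: "r = p" using pt_inner[of "r + 1" b] by (cases "r = p") (auto simp: pt_0)
      then have "[a = b + i] (mod n)" using 2 by (simp add: pt_end pt_0_eq_iff)
      then have "[a - i = b] (mod n)"
        using cong_diff[of a "b + i" n i i] by simp
      then show ?thesis using 2 r pt_cong by force
    qed
  qed
next
  have "(pt (a - j) 0, pt a 0) \<in> E" using chord[of "a - j"] by simp
  moreover have "(pt (a - i) p, pt a 0) \<in> E"
    using path_step[of p "a - i"] p_pos by (simp add: pt_end)
  moreover assume "y \<in> {pt (a + j) 0, pt (a - j) 0, pt a 1, pt (a - i) p}"
  ultimately show "(pt a 0, y) \<in> E"
    using chord[of a] path_step[of 0 a] p_pos E_sym by auto
qed

text \<open>
  In terms of path points, no case distinction between the two kinds of vertices is left, and the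
  ends of the paths are covered: the two names of \<open>u\<^sub>a\<close> have the same image since \<open>t i = \<plusminus>i\<close>.
\<close>

lemma action_pt:
  assumes "0 \<le> r" "r \<le> p + 1"
  shows action_pt_fix: "[t * i = i] (mod n) \<Longrightarrow>
      subdiv_action n i p j (s, t) (pt a r) = pt (s + t * a) r"
    and action_pt_flip: "[t * i = - i] (mod n) \<Longrightarrow>
      subdiv_action n i p j (s, t) (pt a r) = pt (s + t * a - i) (p + 1 - r)"
proof -
  have red: "(s + t * (b mod n)) mod n = (s + t * b) mod n" for b
    by (metis mod_add_right_eq mod_mult_right_eq)
  have orig: "subdiv_action n i p j (s, t) (pt b 0) = pt (s + t * b) 0" for b
    using pt_mem[of b 0] by (simp add: subdiv_action_def pt_0 red)
  have cases: "r = 0 \<or> 1 \<le> r \<and> r \<le> p \<or> r = p + 1"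
    using assms by linarith
  then show "subdiv_action n i p j (s, t) (pt a r) = pt (s + t * a) r"
    if "[t * i = i] (mod n)"
  proof (elim disjE)
    assume "1 \<le> r \<and> r \<le> p"
    then show ?thesis
      using that pt_mem[of a r] by (simp add: subdiv_action_def pt_inner red)
  next
    assume "r = p + 1"
    moreover have "[s + t * (a + i) = s + t * a + i] (mod n)"
      using cong_add[OF cong_refl that, of "s + t * a"] by (simp add: algebra_simps)
    ultimately show ?thesis
      by (simp add: pt_end orig pt_0_eq_iff)
  qed (simp add: orig)
  show "subdiv_action n i p j (s, t) (pt a r) = pt (s + t * a - i) (p + 1 - r)"
    if t: "[t * i = - i] (mod n)"
  proof -
    have "\<not> [t * i = i] (mod n)"
      using t not_cong_i_uminus_i by blast
    from cases show ?thesis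
    proof (elim disjE)
      assume "r = 0"
      then show ?thesis by (simp add: orig pt_end)
    next
      assume "1 \<le> r \<and> r \<le> p"
      moreover have "[s + t * (a mod n) - i = s + t * a - i] (mod n)"
        by (intro cong_diff cong_refl) (simp add: cong_def red)
      ultimately show ?thesis
        using t \<open>\<not> [t * i = i] (mod n)\<close> pt_mem[of a r]
        by (simp add: subdiv_action_def pt_inner cong_def)
    next
      assume "r = p + 1"
      moreover have "[s + t * (a + i) = s + t * a - i] (mod n)"
        using cong_add[OF cong_refl t, of "s + t * a"] by (simp add: algebra_simps)
      ultimately show ?thesis
        by (simp add: pt_end orig pt_0_eq_iff)
    qed
  qed
qed

section \<open>The action of the semidirect product\<close>

sublocale residues n "residue_ring n"
  using n_gt_1 by unfold_locales simp

abbreviation "act \<equiv> subdiv_action n i p j"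
abbreviation "K \<equiv> semidirect (residue_ring n) (H' n i j)"

lemma Units_iff: "t \<in> Units (residue_ring n) \<longleftrightarrow> 0 < t \<and> t < n \<and> coprime t n"
  by (simp add: res_units_eq)

lemma H'_iff:
  "t \<in> H' n i j \<longleftrightarrow> 0 < t \<and> t < n \<and> coprime t n \<and>
     ([t * i = i] (mod n) \<or> [t * i = - i] (mod n)) \<and>
     ([t * j = j] (mod n) \<or> [t * j = - j] (mod n))"
  unfolding H'_def image_signed_pair_iff by (auto simp: Units_iff)

lemma action_orig: "act (s, t) (pt a 0) = pt (s + t * a) 0"
  using pt_mem[of a 0] mod_add_right_eq[of s "t * (a mod n)" n] mod_add_right_eq[of s "t * a" n]
  by (simp add: subdiv_action_def pt_0 mod_mult_right_eq)

lemma action_mem: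
  assumes "t \<in> H' n i j" "x \<in> V"
  shows "act (s, t) x \<in> V"
  using assms(2)
proof (cases rule: vertex_cases)
  case (1 a r)
  then show ?thesis
    using assms(1) action_pt[of r t s a] pt_mem by (auto simp: H'_iff)
qed

lemma action_arc:
  assumes t: "t \<in> H' n i j" and arc: "(x, y) \<in> E"
  shows "(act (s, t) x, act (s, t) y) \<in> E"
proof -
  have "(act (s, t) x, act (s, t) y) \<in> E" if "(x, y) \<in> subdiv_arcs n i p j" for x y
    using that unfolding arcs_cases
  proof (elim disjE exE conjE)
    fix a assume xy: "x = pt a 0" "y = pt (a + j) 0"
    have eq: "act (s, t) x = pt (s + t * a) 0" "act (s, t) y = pt (s + t * a + t * j) 0"
      by (simp_all add: xy action_orig algebra_simps)
    consider "[t * j = j] (mod n)" | "[t * j = - j] (mod n)"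
      using t by (auto simp: H'_iff)
    then show ?thesis
    proof cases
      case 1
      then have "act (s, t) y = pt (s + t * a + j) 0"
        unfolding eq by (intro pt_cong cong_add cong_refl)
      then show ?thesis using chord[of "s + t * a"] eq by simp
    next
      case 2
      then have "act (s, t) y = pt (s + t * a + - j) 0"
        unfolding eq by (intro pt_cong cong_add cong_refl)
      then show ?thesis using chord[of "s + t * a - j"] eq E_sym by simp
    qed
  next
    fix a r assume xy: "0 \<le> r" "r \<le> p" "x = pt a r" "y = pt a (r + 1)"
    consider "[t * i = i] (mod n)" | "[t * i = - i] (mod n)"
      using t by (auto simp: H'_iff)
    then show ?thesis
    proof cases
      case 1
      then show ?thesis
        using xy by (simp add: action_pt_fix path_step)
    next
      case 2
      then show ?thesis
        using xy path_step[of "p - r" "s + t * a - i"]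
        by (simp add: action_pt_flip E_sym algebra_simps)
    qed
  qed
  then show ?thesis
    using arc E_iff by blast
qed

text \<open>
  The \<open>i\<close>-signs of \<open>t\<close> and \<open>t'\<close> multiply, and two reversals cancel: since \<open>t i = - i\<close>, the
  second one turns the shift by \<open>- i\<close> of the first into a shift by \<open>i\<close>, which makes up for its own
  shift by \<open>- i\<close>.
\<close>

lemma action_mult:
  assumes t: "t \<in> H' n i j" and t': "t' \<in> H' n i j" and x: "x \<in> V"
  shows "act (s, t) (act (s', t') x) = act ((s + t * s') mod n, t * t' mod n) x"
proof -
  from x obtain a r where r: "x = pt a r" "0 \<le> r" "r \<le> p" by (rule vertex_cases)
  have "[(s + t * s') mod n + (t * t' mod n) * a = (s + t * s') + (t * t') * a] (mod n)"
    by (intro cong_add cong_mult cong_refl) simp_all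
  then have red: "[(s + t * s') mod n + (t * t' mod n) * a = s + t * (s' + t' * a)] (mod n)"
    by (simp add: algebra_simps)
  have tt: "[(t * t' mod n) * i = c * c' * i] (mod n)"
    if "[t * i = c * i] (mod n)" "[t' * i = c' * i] (mod n)" for c c'
  proof -
    have "[(t * t' mod n) * i = t * (t' * i)] (mod n)"
      by (simp add: cong_def mod_simps algebra_simps)
    also have "[t * (t' * i) = t * (c' * i)] (mod n)"
      using that(2) by (rule cong_scalar_left)
    also have "t * (c' * i) = c' * (t * i)" by simp
    also have "[c' * (t * i) = c' * (c * i)] (mod n)"
      using that(1) by (rule cong_scalar_left)
    finally show ?thesis by (simp add: ac_simps)
  qed
  note r' = r(2,3)
  consider "[t * i = i] (mod n)" "[t' * i = i] (mod n)"
    | "[t * i = i] (mod n)" "[t' * i = - i] (mod n)"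
    | "[t * i = - i] (mod n)" "[t' * i = i] (mod n)"
    | "[t * i = - i] (mod n)" "[t' * i = - i] (mod n)"
    using t t' by (auto simp: H'_iff)
  then show ?thesis
  proof cases
    case 1
    then show ?thesis
      using tt[of 1 1] r' pt_cong[OF red] by (simp add: r(1) action_pt_fix)
  next
    case 2
    have "[s + t * (s' + t' * a - i) = s + t * (s' + t' * a) - i] (mod n)"
      using cong_diff[OF cong_refl 2(1), of "s + t * (s' + t' * a)"] by (simp add: algebra_simps)
    then have "[s + t * (s' + t' * a - i) = (s + t * s') mod n + (t * t' mod n) * a - i] (mod n)"
      using cong_diff[OF red cong_refl, of i] by (meson cong_sym cong_trans)
    then show ?thesis
      using 2 tt[of 1 "-1"] r' pt_cong by (simp add: r(1) action_pt_fix action_pt_flip)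
  next
    case 3
    then show ?thesis
      using tt[of "-1" 1] r' pt_cong[OF cong_diff[OF red cong_refl]]
      by (simp add: r(1) action_pt_fix action_pt_flip)
  next
    case 4
    have "[s + t * (s' + t' * a - i) = s + t * (s' + t' * a) + i] (mod n)"
      using cong_diff[OF cong_refl 4(1), of "s + t * (s' + t' * a)"] by (simp add: algebra_simps)
    then have "[s + t * (s' + t' * a - i) - i = s + t * (s' + t' * a) + i - i] (mod n)"
      by (intro cong_diff cong_refl)
    then have "[s + t * (s' + t' * a - i) - i = (s + t * s') mod n + (t * t' mod n) * a] (mod n)"
      using red by (simp, meson cong_sym cong_trans)
    then show ?thesis
      using 4 tt[of "-1" "-1"] r' pt_cong by (simp add: r(1) action_pt_fix action_pt_flip)
  qed
qed

lemma action_one: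
  assumes "x \<in> V"
  shows "act (0, 1) x = x"
  using assms by (cases rule: vertex_cases) (simp add: action_pt_fix)

lemma K_mem: "(s, t) \<in> carrier K \<longleftrightarrow> 0 \<le> s \<and> s < n \<and> t \<in> H' n i j"
  by (auto simp: semidirect_def carrier_iff)

lemma K_mult: "(s, t) \<otimes>\<^bsub>K\<^esub> (s', t') = ((s + t * s') mod n, t * t' mod n)"
  by (simp add: semidirect_def res_add_eq res_mult_eq mod_simps)

lemma K_one: "\<one>\<^bsub>K\<^esub> = (0, 1)"
  by (simp add: semidirect_def res_zero_eq res_one_eq n_gt_1)

lemma K_group: "group K"
  by (rule group_semidirect[OF ring_axioms subgroup_H'[OF n_gt_1]])

text \<open>
  With the inverse group element, bijectivity and the reflection of arcs both follow from closure
  and from the preservation of arcs.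
\<close>

lemma action_inverse:
  assumes "g \<in> carrier K"
  obtains h where "h \<in> carrier K" "\<And>x. x \<in> V \<Longrightarrow> act h (act g x) = x"
    "\<And>x. x \<in> V \<Longrightarrow> act g (act h x) = x"
proof -
  interpret K: group K by (rule K_group)
  have mult: "act g (act h x) = act (g \<otimes>\<^bsub>K\<^esub> h) x"
    if "g \<in> carrier K" "h \<in> carrier K" "x \<in> V" for g h x
    using that by (cases g; cases h) (simp add: K_mem K_mult action_mult)
  show ?thesis
    using assms that[of "inv\<^bsub>K\<^esub> g"] by (simp add: mult K_one action_one)
qed

lemma action_aut:
  assumes g: "g \<in> carrier K"
  shows "act g \<in> graph_auts G"
proof -
  obtain h where h: "h \<in> carrier K" "\<And>x. x \<in> V \<Longrightarrow> act h (act g x) = x"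
    "\<And>x. x \<in> V \<Longrightarrow> act g (act h x) = x"
    using action_inverse[OF g] by metis
  have mem: "act k x \<in> V" if "k \<in> carrier K" "x \<in> V" for k x
    using that by (cases k) (simp add: K_mem action_mem)
  have arc: "(act k x, act k y) \<in> E" if "k \<in> carrier K" "(x, y) \<in> E" for k x y
    using that by (cases k) (simp add: K_mem action_arc)
  have "bij_betw (act g) V V"
    by (rule bij_betw_byWitness[where f' = "act h"]) (use h mem[OF g] mem[OF h(1)] in auto)
  moreover have "act g \<in> extensional V"
    by (cases g) (simp add: subdiv_action_def)
  moreover have "(x, y) \<in> E \<longleftrightarrow> (act g x, act g y) \<in> E" if "x \<in> V" "y \<in> V" for x y
    using that arc[OF g, of x y] arc[OF h(1), of "act g x" "act g y"] h(2) by auto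
  ultimately show ?thesis
    by (simp add: graph_auts_def Bij_def)
qed


text \<open>
  The images of \<open>u\<^sub>0\<close> and \<open>u\<^sub>1\<close> give \<open>s\<close> and \<open>s + t\<close>.
\<close>

lemma action_inj: "inj_on act (carrier K)"
proof (rule inj_onI, clarify)
  fix s t s' t'
  assume K: "(s, t) \<in> carrier K" "(s', t') \<in> carrier K" and eq: "act (s, t) = act (s', t')"
  have "pt (s + t * a) 0 = pt (s' + t' * a) 0" for a
    using fun_cong[OF eq, of "pt a 0"] by (simp add: action_orig)
  then have cong: "[s + t * a = s' + t' * a] (mod n)" for a
    by (simp add: pt_0_eq_iff)
  have s: "s = s'"
    using cong[of 0] K by (simp add: K_mem cong_def)
  moreover have "t = t'"
  proof -
    have "[t = t'] (mod n)"
      using cong[of 1] by (simp add: s cong_add_lcancel)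
    then show ?thesis
      using K by (simp add: K_mem H'_iff cong_def)
  qed
  ultimately show "s = s' \<and> t = t'" by simp
qed

section \<open>Automorphisms of the subdivided circulant\<close>

abbreviation nbrs :: "subdiv_vertex \<Rightarrow> subdiv_vertex set" where
  "nbrs x \<equiv> {y. (x, y) \<in> E}"

lemma nbrs_inner:
  assumes "1 \<le> r" "r \<le> p"
  shows "nbrs (pt a r) = {pt a (r - 1), pt a (r + 1)}"
  using inner_nbrs[OF assms] by auto

lemma nbrs_orig: "nbrs (pt a 0) = {pt (a + j) 0, pt (a - j) 0, pt a 1, pt (a - i) p}"
  using orig_nbrs by auto

text \<open>
  For \<open>p = 1\<close> the two points are the ends of the path, which differ because \<open>i\<close> is not \<open>0\<close> modulo
  \<open>n\<close>; otherwise one of them is an inner point.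
\<close>

lemma path_no_backtrack:
  assumes "1 \<le> r" "r \<le> p"
  shows "pt a (r + 1) \<noteq> pt a (r - 1)"
proof
  assume eq: "pt a (r + 1) = pt a (r - 1)"
  consider "r < p" | "1 < r" | "r = 1" "r = p"
    using assms by linarith
  then show False
  proof cases
    case 1
    then show ?thesis using eq pt_eq_inner_iff[of "r + 1" a "r - 1" a] assms by auto
  next
    case 2
    then show ?thesis using eq pt_eq_inner_iff[of "r - 1" a "r + 1" a] assms by auto
  next
    case 3
    then have "pt a (p + 1) = pt a 0"
      using eq by simp
    then have "[a + i = a + 0] (mod n)"
      by (simp add: pt_end pt_0_eq_iff)
    then show ?thesis
      using i_not_cong_0 unfolding cong_add_lcancel by contradiction
  qed
qed

text \<open>
  Three neighbours of \<open>u\<^sub>a\<close> are guaranteed, not four: if \<open>2 j = n\<close>, the two \<open>j\<close>-edges at \<open>u\<^sub>a\<close> coincide.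
\<close>

lemma orig_iff_card_nbrs:
  assumes "0 \<le> r" "r \<le> p"
  shows "3 \<le> card (nbrs (pt a r)) \<longleftrightarrow> r = 0"
proof
  assume "3 \<le> card (nbrs (pt a r))"
  moreover have "card (nbrs (pt a r)) \<le> 2" if "1 \<le> r"
    using that assms(2) card_insert_le_m1[of 2 "{pt a (r + 1)}"] by (simp add: nbrs_inner)
  ultimately show "r = 0"
    using assms(1) by fastforce
next
  assume r: "r = 0"
  have "\<not> [a - i = a] (mod n)"
    using i_not_cong_0 by (simp add: cong_iff_dvd_diff)
  then have "pt (a - i) p \<noteq> pt a 1"
    using pt_eq_inner_iff[of 1 "a - i" p a] p_pos by auto
  moreover have "pt (a + j) 0 \<noteq> pt a 1" "pt (a + j) 0 \<noteq> pt (a - i) p"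
    using pt_eq_inner_iff[of 1 "a + j" 0 a] pt_eq_inner_iff[of p "a + j" 0 "a - i"] p_pos by auto
  ultimately have "card {pt (a + j) 0, pt a 1, pt (a - i) p} = 3"
    by auto
  moreover have "card {pt (a + j) 0, pt a 1, pt (a - i) p} \<le> card (nbrs (pt a 0))"
    by (rule card_mono) (auto simp: nbrs_orig)
  ultimately show "3 \<le> card (nbrs (pt a r))"
    using r by simp
qed

context
  fixes f :: "subdiv_vertex \<Rightarrow> subdiv_vertex"
  assumes f: "f \<in> graph_auts G"
begin

lemma aut_mem: "x \<in> V \<Longrightarrow> f x \<in> V"
  using f by (auto simp: graph_auts_def Bij_def bij_betw_def)

lemma aut_image: "f ` V = V"
  using f by (auto simp: graph_auts_def Bij_def bij_betw_def)

lemma aut_inj: "x \<in> V \<Longrightarrow> y \<in> V \<Longrightarrow> f x = f y \<longleftrightarrow> x = y"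
  using f by (auto simp: graph_auts_def Bij_def bij_betw_def dest: inj_onD)

lemma aut_arc: "x \<in> V \<Longrightarrow> y \<in> V \<Longrightarrow> (f x, f y) \<in> E \<longleftrightarrow> (x, y) \<in> E"
  using f by (auto simp: graph_auts_def)

lemma nbrs_subset: "nbrs x \<subseteq> V"
  by (auto simp: E_iff arcs_cases pt_mem)

lemma aut_nbrs:
  assumes "x \<in> V"
  shows "nbrs (f x) = f ` nbrs x" and "card (nbrs (f x)) = card (nbrs x)"
proof -
  show eq: "nbrs (f x) = f ` nbrs x"
  proof
    show "f ` nbrs x \<subseteq> nbrs (f x)"
      using assms nbrs_subset[of x] aut_arc by auto
    show "nbrs (f x) \<subseteq> f ` nbrs x"
    proof
      fix y assume y: "y \<in> nbrs (f x)"
      then obtain z where "z \<in> V" "y = f z"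
        using nbrs_subset[of "f x"] aut_image by blast
      then show "y \<in> f ` nbrs x"
        using y aut_arc[OF assms] by auto
    qed
  qed
  show "card (nbrs (f x)) = card (nbrs x)"
    unfolding eq using nbrs_subset[of x] aut_inj by (intro card_image inj_onI) blast
qed

lemma aut_orig: "\<exists>b. f (pt a 0) = pt b 0"
proof -
  obtain b r where br: "f (pt a 0) = pt b r" "0 \<le> r" "r \<le> p"
    using aut_mem[OF pt_mem] by (rule vertex_cases)
  have "3 \<le> card (nbrs (pt b r))"
    using aut_nbrs(2)[OF pt_mem, of a 0] orig_iff_card_nbrs[of 0 a] p_pos br(1) by simp
  then show ?thesis
    using br orig_iff_card_nbrs by auto
qed

text \<open>
  Stated for a sequence \<open>w\<close> of vertices rather than a path, so that it serves both for a path and for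
  the reversal of one. At each inner point the image must go on to the only neighbour of \<open>w r\<close> that
  it has not just left.
\<close>

lemma aut_follows_path:
  assumes w: "\<And>r. 1 \<le> r \<Longrightarrow> r \<le> p \<Longrightarrow> nbrs (w r) = {w (r - 1), w (r + 1)}"
    and start: "f (pt a 0) = w 0" "f (pt a 1) = w 1"
    and r: "0 \<le> r" "r \<le> p + 1"
  shows "f (pt a r) = w r"
proof -
  have "s \<le> p \<longrightarrow> f (pt a s) = w s \<and> f (pt a (s + 1)) = w (s + 1)" if "0 \<le> s" for s
    using that
  proof (induction s rule: int_ge_induct)
    case base
    then show ?case using start by simp
  next
    case (step s)
    show ?case
    proof
      assume s: "s + 1 \<le> p"
      then have IH: "f (pt a s) = w s" "f (pt a (s + 1)) = w (s + 1)"
        using step by auto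
      have "f (pt a (s + 2)) \<in> nbrs (f (pt a (s + 1)))"
        using aut_arc[OF pt_mem pt_mem] path_step[of "s + 1" a] s step(1) by (simp add: add.assoc)
      then have "f (pt a (s + 2)) = w s \<or> f (pt a (s + 2)) = w (s + 2)"
        using w[of "s + 1"] s step(1) by (simp add: IH add.assoc)
      moreover have "f (pt a (s + 2)) \<noteq> f (pt a s)"
        using path_no_backtrack[of "s + 1" a] s step(1) aut_inj[OF pt_mem pt_mem]
        by (simp add: add.assoc)
      ultimately show "f (pt a (s + 1)) = w (s + 1) \<and> f (pt a (s + 1 + 1)) = w (s + 1 + 1)"
        using IH by (simp add: add.assoc)
    qed
  qed
  from this[of r] this[of "r - 1"] r p_pos show ?thesis
    by (cases "r = p + 1") auto
qed

text \<open>
  At \<open>pt b 0\<close> exactly two neighbours have degree two: the first point of the path that starts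
  there and the last inner point of the path that ends there. The image of \<open>pt a 1\<close> decides which
  of the two is followed.
\<close>

lemma aut_path:
  assumes b: "f (pt a 0) = pt b 0"
  shows "(\<forall>r. 0 \<le> r \<and> r \<le> p + 1 \<longrightarrow> f (pt a r) = pt b r) \<or>
    (\<forall>r. 0 \<le> r \<and> r \<le> p + 1 \<longrightarrow> f (pt a r) = pt (b - i) (p + 1 - r))"
proof -
  have card: "\<not> 3 \<le> card (nbrs (f (pt a 1)))"
    using aut_nbrs(2)[OF pt_mem, of a 1] orig_iff_card_nbrs[of 1 a] p_pos by simp
  have "f (pt a 1) \<in> nbrs (f (pt a 0))"
    using aut_arc[OF pt_mem pt_mem] path_step[of 0 a] p_pos by simp
  then have "f (pt a 1) \<in> {pt (b + j) 0, pt (b - j) 0, pt b 1, pt (b - i) p}"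
    by (simp only: b nbrs_orig)
  moreover have "f (pt a 1) \<noteq> pt c 0" for c
    using card orig_iff_card_nbrs[of 0 c] p_pos by auto
  ultimately consider "f (pt a 1) = pt b 1" | "f (pt a 1) = pt (b - i) p"
    by auto
  then show ?thesis
  proof cases
    case 1
    have "f (pt a r) = pt b r" if "0 \<le> r" "r \<le> p + 1" for r
      by (rule aut_follows_path[of "pt b", OF nbrs_inner b 1 that])
    then show ?thesis by blast
  next
    case 2
    have "f (pt a r) = pt (b - i) (p + 1 - r)" if "0 \<le> r" "r \<le> p + 1" for r
    proof (rule aut_follows_path[of "\<lambda>r. pt (b - i) (p + 1 - r)", OF _ _ _ that])
      show "nbrs (pt (b - i) (p + 1 - r)) =
          {pt (b - i) (p + 1 - (r - 1)), pt (b - i) (p + 1 - (r + 1))}" if "1 \<le> r" "r \<le> p" for r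
        using that nbrs_inner[of "p + 1 - r" "b - i"] by (auto simp: algebra_simps)
    qed (use b 2 pt_end[of "b - i"] in simp_all)
    then show ?thesis by blast
  qed
qed

lemma aut_is_action:
  assumes bezout: "[u * i + v * j = 1] (mod n)"
    and units: "i = 1 \<or> \<not> coprime i n \<and> \<not> coprime j n"
  shows "f \<in> act ` carrier K"
proof -
  obtain h where h: "\<And>a. f (pt a 0) = pt (h a) 0"
    using aut_orig by metis
  have cong: "[x = y] (mod n) \<longleftrightarrow> [h x = h y] (mod n)" for x y
    using aut_inj[OF pt_mem pt_mem, of x 0 y 0] by (simp add: h pt_0_eq_iff)
  \<comment> \<open>The direction in which a path is followed is kept together with the sign of the step of \<open>h\<close>: below,
    the sign tells whether \<open>t\<close> fixes or negates \<open>i\<close>, and the direction is then that of the action.\<close>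
  have i_cases: "[h (x + i) = h x + i] (mod n) \<and> (\<forall>r. 0 \<le> r \<and> r \<le> p + 1 \<longrightarrow> f (pt x r) = pt (h x) r) \<or>
      [h (x + i) = h x - i] (mod n) \<and>
        (\<forall>r. 0 \<le> r \<and> r \<le> p + 1 \<longrightarrow> f (pt x r) = pt (h x - i) (p + 1 - r))" for x
    using aut_path[OF h, of x]
  proof (elim disjE)
    assume *: "\<forall>r. 0 \<le> r \<and> r \<le> p + 1 \<longrightarrow> f (pt x r) = pt (h x) r"
    then have "pt (h (x + i)) 0 = pt (h x + i) 0"
      using p_pos by (simp flip: h pt_end)
    with * show ?thesis by (simp add: pt_0_eq_iff)
  next
    assume *: "\<forall>r. 0 \<le> r \<and> r \<le> p + 1 \<longrightarrow> f (pt x r) = pt (h x - i) (p + 1 - r)"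
    then have "f (pt x (p + 1)) = pt (h x - i) 0"
      using p_pos by simp
    then have "pt (h (x + i)) 0 = pt (h x - i) 0"
      by (simp add: h pt_end)
    with * show ?thesis by (simp add: pt_0_eq_iff)
  qed
  have i_step: "[h (x + i) = h x + i] (mod n) \<or> [h (x + i) = h x - i] (mod n)" for x
    using i_cases[of x] by blast
  have j_step: "[h (x + j) = h x + j] (mod n) \<or> [h (x + j) = h x - j] (mod n)" for x
  proof -
    have "f (pt (x + j) 0) \<in> nbrs (f (pt x 0))"
      using aut_arc[OF pt_mem pt_mem] chord by simp
    then have "pt (h (x + j)) 0 \<in> {pt (h x + j) 0, pt (h x - j) 0, pt (h x) 1, pt (h x - i) p}"
      by (simp only: h nbrs_orig)
    moreover have "pt (h (x + j)) 0 \<noteq> pt (h x) 1" "pt (h (x + j)) 0 \<noteq> pt (h x - i) p"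
      using pt_eq_inner_iff[of 1 "h (x + j)" 0 "h x"]
        pt_eq_inner_iff[of p "h (x + j)" 0 "h x - i"] p_pos by auto
    ultimately show ?thesis
      by (simp add: pt_0_eq_iff)
  qed
  obtain t where affine: "\<And>x. [h x = h 0 + t * x] (mod n)"
    and ti: "[t * i = i] (mod n) \<or> [t * i = - i] (mod n)"
    and tj: "[t * j = j] (mod n) \<or> [t * j = - j] (mod n)"
    using cong_map_affine[OF cong i_step j_step two_i_not_cong_0 bezout units] by metis
  \<comment> \<open>Surjectivity of \<open>f\<close> makes \<open>t\<close> a unit: the preimage of \<open>u\<^bsub>h 0 + 1\<^esub>\<close> is some \<open>u\<^sub>x\<close> by its degree.\<close>
  obtain x where "[t * x = 1] (mod n)"
  proof -
    obtain y where y: "y \<in> V" "f y = pt (h 0 + 1) 0"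
      using pt_mem[of "h 0 + 1" 0] aut_image by (metis imageE)
    from y(1) obtain x r where xr: "y = pt x r" "0 \<le> r" "r \<le> p" by (rule vertex_cases)
    have "3 \<le> card (nbrs (pt x r))"
      using aut_nbrs(2)[OF y(1)] orig_iff_card_nbrs[of 0 "h 0 + 1"] p_pos y(2) xr(1) by simp
    then have "r = 0" using xr orig_iff_card_nbrs by blast
    then have "[h x = h 0 + 1] (mod n)"
      using y(2) xr(1) by (simp add: h pt_0_eq_iff)
    then have "[h 0 + t * x = h 0 + 1] (mod n)"
      using affine[of x] by (meson cong_sym cong_trans)
    then show ?thesis using that by (simp only: cong_add_lcancel)
  qed
  then have "coprime t n"
    using coprime_iff_invertible_int by blast
  define s' t' where "s' = h 0 mod n" and "t' = t mod n"
  have t'_mult: "[t' * x = t * x] (mod n)" for x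
    by (simp add: t'_def cong_def mod_mult_left_eq)
  have "coprime t' n" "0 \<le> t'" "t' < n"
    using \<open>coprime t n\<close> n_gt_1 by (simp_all add: t'_def)
  moreover have "t' \<noteq> 0"
    using \<open>coprime t' n\<close> n_gt_1 by auto
  moreover have "[t' * i = i] (mod n) \<or> [t' * i = - i] (mod n)"
    "[t' * j = j] (mod n) \<or> [t' * j = - j] (mod n)"
    using ti tj t'_mult cong_trans by blast+
  ultimately have K: "(s', t') \<in> carrier K"
    using n_gt_1 by (simp add: K_mem H'_iff s'_def)
  have affine': "[h x = s' + t' * x] (mod n)" for x
  proof -
    have "[h 0 + t * x = s' + t' * x] (mod n)"
      using t'_mult[of x] by (intro cong_add) (simp_all add: s'_def cong_sym_eq)
    with affine show ?thesis by (rule cong_trans)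
  qed
  have "f x = act (s', t') x" if "x \<in> V" for x
  proof -
    from that obtain a r where x: "x = pt a r" and r: "0 \<le> r" "r \<le> p" by (rule vertex_cases)
    have step: "[h (a + i) = h a + t' * i] (mod n)"
    proof -
      have "[h (a + i) = s' + t' * a + t' * i] (mod n)"
        using affine'[of "a + i"] by (simp add: algebra_simps)
      also have "[s' + t' * a + t' * i = h a + t' * i] (mod n)"
        using affine'[of a] by (simp add: cong_add_rcancel cong_sym_eq)
      finally show ?thesis .
    qed
    show ?thesis
      using i_cases[of a]
    proof (elim disjE conjE)
      assume "[h (a + i) = h a + i] (mod n)"
        and *: "\<forall>r. 0 \<le> r \<and> r \<le> p + 1 \<longrightarrow> f (pt a r) = pt (h a) r"
      then have "[h a + t' * i = h a + i] (mod n)"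
        using step by (meson cong_sym cong_trans)
      then have "[t' * i = i] (mod n)" by (simp only: cong_add_lcancel)
      then show ?thesis
        using * r pt_cong[OF affine'] by (simp add: x action_pt_fix)
    next
      assume "[h (a + i) = h a - i] (mod n)"
        and *: "\<forall>r. 0 \<le> r \<and> r \<le> p + 1 \<longrightarrow> f (pt a r) = pt (h a - i) (p + 1 - r)"
      then have "[h a + t' * i = h a + - i] (mod n)"
        using step by (simp, meson cong_sym cong_trans)
      then have "[t' * i = - i] (mod n)" by (simp only: cong_add_lcancel)
      then show ?thesis
        using * r pt_cong[OF cong_diff[OF affine' cong_refl]] by (simp add: x action_pt_flip)
    qed
  qed
  moreover have "f \<in> extensional V" "act (s', t') \<in> extensional V"
    using f by (simp_all add: graph_auts_def Bij_def subdiv_action_def)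
  ultimately have "f = act (s', t')"
    by (intro extensionalityI)
  with K show ?thesis by blast
qed

end

end

section \<open>The automorphism group\<close>

theorem theorem18:
  fixes n i j p :: int
  assumes "0 < i" and "i < j" and "2 * j \<le> n" and "1 \<le> p"
    and "i = 1 \<or> (i \<notin> Units (residue_ring n) \<and> j \<notin> Units (residue_ring n))"
    and "Digraph_Component.connected (with_proj (circulant n i j))"
  shows "subdiv_action n i p j \<in>
    iso (semidirect (residue_ring n) (H' n i j)) (graph_aut_group (subdivided_circulant n i p j))"
proof -
  interpret circulant_subdivision n i j p
    using assms by unfold_locales
  have "i < n" "j < n" "0 < j" using assms by linarith+
  then have units: "i = 1 \<or> \<not> coprime i n \<and> \<not> coprime j n"
    using assms(1,5) by (auto simp: Units_iff)
  obtain u v where bezout: "[u * i + v * j = 1] (mod n)"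
    using circulant_connected_bezout[OF n_gt_1 assms(6)] .
  have carrier: "carrier (graph_aut_group G) = graph_auts G"
    by (simp add: graph_aut_group_def)
  have "act ` carrier K = graph_auts G"
    using action_aut aut_is_action[OF _ bezout units] by blast
  then have "bij_betw act (carrier K) (carrier (graph_aut_group G))"
    using action_inj by (simp add: bij_betw_def carrier)
  moreover have "act \<in> hom K (graph_aut_group G)"
  proof (rule homI)
    fix x y assume x: "x \<in> carrier K" and y: "y \<in> carrier K"
    have Bij: "act x \<in> Bij V" "act y \<in> Bij V"
      using action_aut x y by (auto simp: graph_auts_def)
    have xy: "x \<otimes>\<^bsub>K\<^esub> y \<in> carrier K"
      using K_group x y by (simp add: group.is_monoid monoid.m_closed)
    have "compose V (act x) (act y) = act (x \<otimes>\<^bsub>K\<^esub> y)"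
    proof (rule extensionalityI[of _ V])
      show "act (x \<otimes>\<^bsub>K\<^esub> y) \<in> extensional V"
        using action_aut[OF xy] by (simp add: graph_auts_def Bij_def)
      show "compose V (act x) (act y) z = act (x \<otimes>\<^bsub>K\<^esub> y) z" if "z \<in> V" for z
        using that x y by (cases x; cases y) (simp add: compose_eq K_mem K_mult action_mult)
    qed (rule compose_extensional)
    then show "act (x \<otimes>\<^bsub>K\<^esub> y) = act x \<otimes>\<^bsub>graph_aut_group G\<^esub> act y"
      using Bij by (simp add: graph_aut_group_def BijGroup_def)
  qed (simp add: carrier action_aut)
  ultimately show ?thesis
    by (simp add: iso_def)
qed

end
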